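(* Let $X(t)$, $t\in[0,1]$, be an $\alpha(\cdot)$-locally stationary random process whose smoothness index $\alpha(\cdot)$ satisfies: (C1) $\alpha(\cdot)$ attains its global minimum over $[0,1]$ at the unique point $0$; put $\alpha_0:=\alpha(0)$; (C2) there exist $b,\gamma>0$ such that $\alpha(t)=\alpha_0+b\,t^{\gamma}+o(t^{\gamma})$ as $t\to 0$. Let $T_n=\{0=t_0(n)<t_1(n)<\dots<t_{N_n}(n)=1\}$, $n\ge1$, be any sequence of sampling designs such that $N_n\sim n$ and $|T_n|:=\max_{1\le j\le N_n}(t_j(n)-t_{j-1}(n))\to0$ as $n\to\infty$, and let $X_n$ be the piecewise constant approximations of $X$ constructed according to the designs $T_n$. Then $$\liminf_{n\to\infty}\; n^{\alpha_0}(\log n)^{(\alpha_0+1)/\gamma}\int_0^1\mathbb{E}\{(X(t)-X_n(t))^2\}\,dt\;>\;0.$$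
   Context: Write $\|Y\|:=(\mathbb{E}Y^2)^{1/2}$ for a random variable $Y$. A random process $X(t)$, $t\in[0,1]$, with $\mathbb{E}\{X(t)^2\}<\infty$ is called $\alpha(\cdot)$-locally stationary if there are continuous functions $\alpha(\cdot),c(\cdot)$ on $[0,1]$ with $0<\alpha(t)\le 2$ and $c(t)>0$ such that $$\lim_{s\to0}\frac{\|X(t+s)-X(t)\|^2}{|s|^{\alpha(t)}}=c(t)\quad\text{uniformly in } t\in[0,1]$$ (with $s\neq 0$ and $t+s\in[0,1]$). Given knots $0=t_0<t_1<\dots<t_N=1$ (a sampling design), the piecewise constant approximation is $X_n(t):=X(t_{j-1})$ for $t_{j-1}\le t<t_j$, $j=1,\dots,N$. $a_n\sim b_n$ means $a_n/b_n\to1$. *)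

theory Defs
  imports "HOL-Probability.Probability" "HOL-Library.Landau_Symbols"
begin

definition rv_norm :: "'a measure \<Rightarrow> ('a \<Rightarrow> real) \<Rightarrow> real" where
  "rv_norm M Y = sqrt (\<integral>\<omega>. (Y \<omega>)\<^sup>2 \<partial>M)"

text \<open>Only the values \<open>X t\<close> with \<open>t \<in> {0..1}\<close> are relevant.\<close>

definition second_order_process :: "'a measure \<Rightarrow> (real \<Rightarrow> 'a \<Rightarrow> real) \<Rightarrow> bool" where
  "second_order_process M X \<longleftrightarrow>
     (\<forall>t\<in>{0..1}. X t \<in> borel_measurable M \<and> integrable M (\<lambda>\<omega>. (X t \<omega>)\<^sup>2))"

text \<open>The uniform limit is spelled out with \<open>\<epsilon>\<close> and \<open>\<delta>\<close> because the range of
  admissible \<open>s\<close> (those with \<open>t + s \<in> {0..1}\<close>) depends on \<open>t\<close>, which \<^const>\<open>uniform_limit\<close>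
  does not accommodate.\<close>

definition locally_stationary ::
    "'a measure \<Rightarrow> (real \<Rightarrow> 'a \<Rightarrow> real) \<Rightarrow> (real \<Rightarrow> real) \<Rightarrow> bool" where
  "locally_stationary M X \<alpha> \<longleftrightarrow>
     second_order_process M X \<and>
     continuous_on {0..1} \<alpha> \<and> (\<forall>t\<in>{0..1}. 0 < \<alpha> t \<and> \<alpha> t \<le> 2) \<and>
     (\<exists>c. continuous_on {0..1} c \<and> (\<forall>t\<in>{0..1}. 0 < c t) \<and>
       (\<forall>\<epsilon>>0. \<exists>\<delta>>0. \<forall>t\<in>{0..1}. \<forall>s. s \<noteq> 0 \<and> \<bar>s\<bar> < \<delta> \<and> t + s \<in> {0..1} \<longrightarrow>
          \<bar>(rv_norm M (\<lambda>\<omega>. X (t + s) \<omega> - X t \<omega>))\<^sup>2 / \<bar>s\<bar> powr \<alpha> t - c t\<bar> < \<epsilon>))"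

text \<open>A design with \<open>N + 1\<close> knots is represented by its knots \<open>\<tau> 0, \<dots>, \<tau> N\<close>; the values
  \<open>\<tau> j\<close> for \<open>j > N\<close> are ignored.\<close>

definition sampling_design :: "nat \<Rightarrow> (nat \<Rightarrow> real) \<Rightarrow> bool" where
  "sampling_design N \<tau> \<longleftrightarrow> \<tau> 0 = 0 \<and> \<tau> N = 1 \<and> (\<forall>j<N. \<tau> j < \<tau> (Suc j))"

definition mesh :: "nat \<Rightarrow> (nat \<Rightarrow> real) \<Rightarrow> real" where
  "mesh N \<tau> = Max ((\<lambda>j. \<tau> (Suc j) - \<tau> j) ` {..<N})"

text \<open>The half-open intervals of a design cover \<open>{0..<1}\<close>. The value at \<open>t = 1\<close>, which the
  formula on these intervals leaves open, is set to \<open>X 1\<close>; this does not affect integrals over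
  \<open>{0..1}\<close>.\<close>

definition pc_approx ::
    "(real \<Rightarrow> 'a \<Rightarrow> real) \<Rightarrow> nat \<Rightarrow> (nat \<Rightarrow> real) \<Rightarrow> real \<Rightarrow> 'a \<Rightarrow> real" where
  "pc_approx X N \<tau> t =
     (if \<exists>j<N. \<tau> j \<le> t \<and> t < \<tau> (Suc j)
      then X (\<tau> (THE j. j < N \<and> \<tau> j \<le> t \<and> t < \<tau> (Suc j)))
      else X t)"

end

theory Submission
  imports Defs
begin

text \<open>
  Only a short initial interval \<open>[0, x)\<close> with \<open>x = (ln n) powr (-1/\<gamma>)\<close> matters. On this interval (C2)
  gives \<open>\<alpha> \<le> \<alpha> 0 + 2b / ln n\<close>, and the excess over \<open>\<alpha> 0\<close> is harmless because
  \<open>n powr (1 / ln n) = e\<close> is constant.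

  A design with \<open>N\<close> intervals cannot approximate \<open>[0, x)\<close> everywhere to within \<open>\<mu> = x / (2N)\<close>:
  the points within distance \<open>\<mu>\<close> to the right of some knot have total length at most \<open>N\<mu> = x/2\<close>, so a
  set of measure at least \<open>x/2\<close> remains (\<open>measure_far_from_knots\<close>). There local stationarity bounds
  the mean square error below by a constant times \<open>\<mu>\<close> to the power \<open>\<alpha> 0 + 2b / ln n\<close>. Hence the
  integrated error is at least a constant times
  \<open>x (x/N) powr (\<alpha> 0 + 2b / ln n)\<close> (\<open>integrated_error_ge\<close>), which for \<open>N \<le> 2n\<close> has the order of
  \<open>n powr (-\<alpha> 0) (ln n) powr (-(\<alpha> 0 + 1) / \<gamma>)\<close> (\<open>rate_bounded_below\<close>).

  Since the Bochner integral of a non-integrable function is \<open>0\<close>, the lower bound on the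
  integrated error also requires the error to be integrable in \<open>t\<close>. It is, because mean square
  continuity of \<open>X\<close> makes it continuous on each interval of the design.
\<close>

section \<open>Mean square continuity\<close>

lemma integrable_mult_of_squares:
  fixes f g :: "'a \<Rightarrow> real"
  assumes [measurable]: "f \<in> borel_measurable M" "g \<in> borel_measurable M"
    and "integrable M (\<lambda>\<omega>. (f \<omega>)\<^sup>2)" "integrable M (\<lambda>\<omega>. (g \<omega>)\<^sup>2)"
  shows "integrable M (\<lambda>\<omega>. f \<omega> * g \<omega>)"
proof (rule Bochner_Integration.integrable_bound)
  show "integrable M (\<lambda>\<omega>. (f \<omega>)\<^sup>2 + (g \<omega>)\<^sup>2)"
    using assms by simp
  have "\<bar>a * c\<bar> \<le> a\<^sup>2 + c\<^sup>2" for a c :: real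
  proof -
    have "2 * \<bar>a\<bar> * \<bar>c\<bar> \<le> a\<^sup>2 + c\<^sup>2"
      using sum_squares_bound[of "\<bar>a\<bar>" "\<bar>c\<bar>"] by simp
    moreover have "0 \<le> \<bar>a\<bar> * \<bar>c\<bar>" by simp
    ultimately have "\<bar>a\<bar> * \<bar>c\<bar> \<le> a\<^sup>2 + c\<^sup>2" by linarith
    then show ?thesis by (simp add: abs_mult)
  qed
  then show "AE \<omega> in M. norm (f \<omega> * g \<omega>) \<le> norm ((f \<omega>)\<^sup>2 + (g \<omega>)\<^sup>2)"
    by simp
qed measurable

lemma integrable_square_diff:
  fixes f g :: "'a \<Rightarrow> real"
  assumes "f \<in> borel_measurable M" "g \<in> borel_measurable M"
    and "integrable M (\<lambda>\<omega>. (f \<omega>)\<^sup>2)" "integrable M (\<lambda>\<omega>. (g \<omega>)\<^sup>2)"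
  shows "integrable M (\<lambda>\<omega>. (f \<omega> - g \<omega>)\<^sup>2)"
  unfolding power2_diff using integrable_mult_of_squares[OF assms] assms(3,4)
  by (simp add: mult.assoc)

text \<open>
  With \<open>D = f - g\<close> and \<open>Y = g - h\<close>, the difference of the two moments is \<open>E D\<^sup>2 + 2 E (D Y)\<close>, and
  \<open>2 \<bar>D Y\<bar> \<le> D\<^sup>2 / \<eta> + \<eta> Y\<^sup>2\<close>. The free parameter \<open>\<eta>\<close> does the work of the Cauchy-Schwarz inequality.
\<close>

lemma second_moment_perturbation:
  fixes f g h :: "'a \<Rightarrow> real"
  assumes meas [measurable]: "f \<in> borel_measurable M" "g \<in> borel_measurable M" "h \<in> borel_measurable M"
    and f: "integrable M (\<lambda>\<omega>. (f \<omega>)\<^sup>2)" and g: "integrable M (\<lambda>\<omega>. (g \<omega>)\<^sup>2)"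
    and h: "integrable M (\<lambda>\<omega>. (h \<omega>)\<^sup>2)" and "\<eta> > 0"
  shows "\<bar>(\<integral>\<omega>. (f \<omega> - h \<omega>)\<^sup>2 \<partial>M) - (\<integral>\<omega>. (g \<omega> - h \<omega>)\<^sup>2 \<partial>M)\<bar>
    \<le> (1 + 1 / \<eta>) * (\<integral>\<omega>. (f \<omega> - g \<omega>)\<^sup>2 \<partial>M) + \<eta> * (\<integral>\<omega>. (g \<omega> - h \<omega>)\<^sup>2 \<partial>M)"
proof -
  have fh: "integrable M (\<lambda>\<omega>. (f \<omega> - h \<omega>)\<^sup>2)" and gh: "integrable M (\<lambda>\<omega>. (g \<omega> - h \<omega>)\<^sup>2)"
    and fg: "integrable M (\<lambda>\<omega>. (f \<omega> - g \<omega>)\<^sup>2)"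
    by (intro integrable_square_diff meas f g h)+
  have pw: "\<bar>(p - r)\<^sup>2 - (q - r)\<^sup>2\<bar> \<le> (1 + 1 / \<eta>) * (p - q)\<^sup>2 + \<eta> * (q - r)\<^sup>2" for p q r :: real
  proof -
    define d y where "d = p - q" and "y = q - r"
    have "0 \<le> (\<bar>d\<bar> - \<eta> * \<bar>y\<bar>)\<^sup>2 / \<eta>"
      using \<open>\<eta> > 0\<close> by simp
    also have "\<dots> = d\<^sup>2 / \<eta> + \<eta> * y\<^sup>2 - 2 * \<bar>d * y\<bar>"
      using \<open>\<eta> > 0\<close> by (simp add: power2_diff abs_mult field_simps power2_eq_square)
    finally have "2 * \<bar>d * y\<bar> \<le> d\<^sup>2 / \<eta> + \<eta> * y\<^sup>2" by simp
    moreover have "(p - r)\<^sup>2 - (q - r)\<^sup>2 = d\<^sup>2 + 2 * (d * y)"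
      by (simp add: d_def y_def power2_eq_square algebra_simps)
    moreover have "\<bar>d\<^sup>2 + 2 * (d * y)\<bar> \<le> d\<^sup>2 + 2 * \<bar>d * y\<bar>"
      using abs_triangle_ineq[of "d\<^sup>2" "2 * (d * y)"] by (simp add: abs_mult)
    ultimately show ?thesis
      by (simp add: d_def[symmetric] y_def[symmetric] algebra_simps)
  qed
  have "\<bar>(\<integral>\<omega>. (f \<omega> - h \<omega>)\<^sup>2 \<partial>M) - (\<integral>\<omega>. (g \<omega> - h \<omega>)\<^sup>2 \<partial>M)\<bar>
      = \<bar>\<integral>\<omega>. (f \<omega> - h \<omega>)\<^sup>2 - (g \<omega> - h \<omega>)\<^sup>2 \<partial>M\<bar>"
    using fh gh by simp
  also have "\<dots> \<le> (\<integral>\<omega>. \<bar>(f \<omega> - h \<omega>)\<^sup>2 - (g \<omega> - h \<omega>)\<^sup>2\<bar> \<partial>M)"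
    by (rule integral_abs_bound)
  also have "\<dots> \<le> (\<integral>\<omega>. (1 + 1 / \<eta>) * (f \<omega> - g \<omega>)\<^sup>2 + \<eta> * (g \<omega> - h \<omega>)\<^sup>2 \<partial>M)"
    using fh gh fg pw by (intro integral_mono) auto
  also have "\<dots> = (1 + 1 / \<eta>) * (\<integral>\<omega>. (f \<omega> - g \<omega>)\<^sup>2 \<partial>M) + \<eta> * (\<integral>\<omega>. (g \<omega> - h \<omega>)\<^sup>2 \<partial>M)"
    using fg gh by simp
  finally show ?thesis .
qed

lemma continuous_on_second_moment_diff:
  fixes X :: "real \<Rightarrow> 'a \<Rightarrow> real"
  assumes meas: "\<And>t. t \<in> S \<Longrightarrow> X t \<in> borel_measurable M"
    and sq: "\<And>t. t \<in> S \<Longrightarrow> integrable M (\<lambda>\<omega>. (X t \<omega>)\<^sup>2)"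
    and lim: "\<And>t. t \<in> S \<Longrightarrow> ((\<lambda>s. \<integral>\<omega>. (X s \<omega> - X t \<omega>)\<^sup>2 \<partial>M) \<longlongrightarrow> 0) (at t within S)"
    and "u \<in> S"
  shows "continuous_on S (\<lambda>t. \<integral>\<omega>. (X t \<omega> - X u \<omega>)\<^sup>2 \<partial>M)"
  unfolding continuous_on_def
proof (intro ballI tendstoI)
  fix t e :: real
  assume t: "t \<in> S" and "e > 0"
  define V where "V = (\<integral>\<omega>. (X t \<omega> - X u \<omega>)\<^sup>2 \<partial>M)"
  define \<eta> where "\<eta> = e / (2 * (V + 1))"
  have "V \<ge> 0" by (simp add: V_def)
  then have \<eta>: "\<eta> > 0" "\<eta> * V < e / 2"
    using \<open>e > 0\<close> by (auto simp: \<eta>_def field_simps)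
  have "((\<lambda>s. (1 + 1 / \<eta>) * (\<integral>\<omega>. (X s \<omega> - X t \<omega>)\<^sup>2 \<partial>M)) \<longlongrightarrow> (1 + 1 / \<eta>) * 0) (at t within S)"
    by (intro tendsto_intros lim t)
  then have "\<forall>\<^sub>F s in at t within S. (1 + 1 / \<eta>) * (\<integral>\<omega>. (X s \<omega> - X t \<omega>)\<^sup>2 \<partial>M) < e / 2"
    using \<open>e > 0\<close> by (intro order_tendstoD(2)) auto
  moreover have "\<forall>\<^sub>F s in at t within S. s \<in> S"
    by (auto simp: eventually_at_filter)
  ultimately show "\<forall>\<^sub>F s in at t within S.
      dist (\<integral>\<omega>. (X s \<omega> - X u \<omega>)\<^sup>2 \<partial>M) (\<integral>\<omega>. (X t \<omega> - X u \<omega>)\<^sup>2 \<partial>M) < e"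
  proof eventually_elim
    case (elim s)
    have "\<bar>(\<integral>\<omega>. (X s \<omega> - X u \<omega>)\<^sup>2 \<partial>M) - V\<bar> \<le> (1 + 1 / \<eta>) * (\<integral>\<omega>. (X s \<omega> - X t \<omega>)\<^sup>2 \<partial>M) + \<eta> * V"
      unfolding V_def using elim t \<open>u \<in> S\<close> \<eta>(1)
      by (intro second_moment_perturbation meas sq)
    then show ?case
      using elim(1) \<eta>(2) unfolding dist_real_def V_def by linarith
  qed
qed

lemma rv_norm_square: "(rv_norm M Y)\<^sup>2 = (\<integral>\<omega>. (Y \<omega>)\<^sup>2 \<partial>M)"
  by (simp add: rv_norm_def)

text \<open>
  The ratio in the definition of local stationarity is bounded near each \<open>t\<close>, and \<open>\<alpha> t > 0\<close>, so the
  increments of \<open>X\<close> at \<open>t\<close> tend to \<open>0\<close> in mean square.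
\<close>

lemma locally_stationary_continuous:
  assumes ls: "locally_stationary M X \<alpha>" and "u \<in> {0..1}"
  shows "continuous_on {0..1} (\<lambda>t. \<integral>\<omega>. (X t \<omega> - X u \<omega>)\<^sup>2 \<partial>M)"
proof (rule continuous_on_second_moment_diff)
  fix t :: real
  assume t: "t \<in> {0..1}"
  from ls t show "X t \<in> borel_measurable M" "integrable M (\<lambda>\<omega>. (X t \<omega>)\<^sup>2)"
    by (auto simp: locally_stationary_def second_order_process_def)
  obtain c where c: "\<And>\<epsilon>. \<epsilon> > 0 \<Longrightarrow> \<exists>\<delta>>0. \<forall>t\<in>{0..1}. \<forall>s. s \<noteq> 0 \<and> \<bar>s\<bar> < \<delta> \<and> t + s \<in> {0..1} \<longrightarrow>
      \<bar>(\<integral>\<omega>. (X (t + s) \<omega> - X t \<omega>)\<^sup>2 \<partial>M) / \<bar>s\<bar> powr \<alpha> t - c t\<bar> < \<epsilon>"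
    using ls unfolding locally_stationary_def rv_norm_square by blast
  obtain \<delta> where \<delta>: "\<delta> > 0" "\<And>s. s \<noteq> 0 \<Longrightarrow> \<bar>s\<bar> < \<delta> \<Longrightarrow> t + s \<in> {0..1} \<Longrightarrow>
      \<bar>(\<integral>\<omega>. (X (t + s) \<omega> - X t \<omega>)\<^sup>2 \<partial>M) / \<bar>s\<bar> powr \<alpha> t - c t\<bar> < 1"
    using c[of 1] t by (metis zero_less_one)
  show "((\<lambda>s. \<integral>\<omega>. (X s \<omega> - X t \<omega>)\<^sup>2 \<partial>M) \<longlongrightarrow> 0) (at t within {0..1})"
  proof (rule tendsto_sandwich)
    show "((\<lambda>_. 0) \<longlongrightarrow> (0::real)) (at t within {0..1})" by simp
    have "\<alpha> t > 0"
      using ls t by (auto simp: locally_stationary_def)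
    then have "((\<lambda>s. (c t + 1) * \<bar>s - t\<bar> powr \<alpha> t) \<longlongrightarrow> (c t + 1) * 0 powr \<alpha> t) (at t within {0..1})"
      by (intro tendsto_intros tendsto_eq_intros tendsto_powr') auto
    then show "((\<lambda>s. (c t + 1) * \<bar>s - t\<bar> powr \<alpha> t) \<longlongrightarrow> 0) (at t within {0..1})"
      by simp
    have "\<forall>\<^sub>F s in at t within {0..1}. s \<in> {0..1} \<and> s \<noteq> t \<and> dist s t < \<delta>"
      using \<delta>(1) by (auto simp: eventually_at intro!: exI[of _ \<delta>])
    then show "\<forall>\<^sub>F s in at t within {0..1}. (\<integral>\<omega>. (X s \<omega> - X t \<omega>)\<^sup>2 \<partial>M) \<le> (c t + 1) * \<bar>s - t\<bar> powr \<alpha> t"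
    proof eventually_elim
      case (elim s)
      then have "\<bar>(\<integral>\<omega>. (X s \<omega> - X t \<omega>)\<^sup>2 \<partial>M) / \<bar>s - t\<bar> powr \<alpha> t - c t\<bar> < 1"
        using \<delta>(2)[of "s - t"] by (simp add: dist_real_def)
      then have "(\<integral>\<omega>. (X s \<omega> - X t \<omega>)\<^sup>2 \<partial>M) / \<bar>s - t\<bar> powr \<alpha> t \<le> c t + 1"
        by linarith
      then show ?case
        using elim by (simp add: pos_divide_le_eq)
    qed
  qed simp
qed fact

text \<open>
  The base point in the definition of local stationarity is taken to be the left point \<open>u\<close>, which
  will be a knot, so that the exponent is \<open>\<alpha> u\<close>. The constant is uniform because \<open>c\<close> is bounded away
  from \<open>0\<close> on the compact unit interval.
\<close>

lemma locally_stationary_increment_ge: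
  assumes "locally_stationary M X \<alpha>"
  obtains k \<delta> where "k > 0" "\<delta> > 0"
    "\<And>u t. 0 \<le> u \<Longrightarrow> u < t \<Longrightarrow> t \<le> 1 \<Longrightarrow> t - u < \<delta> \<Longrightarrow>
       k * (t - u) powr \<alpha> u \<le> (\<integral>\<omega>. (X t \<omega> - X u \<omega>)\<^sup>2 \<partial>M)"
proof -
  obtain c where c: "continuous_on {0..1} c" "\<And>t. t \<in> {0..1} \<Longrightarrow> 0 < c t"
    "\<And>\<epsilon>. \<epsilon> > 0 \<Longrightarrow> \<exists>\<delta>>0. \<forall>t\<in>{0..1}. \<forall>s. s \<noteq> 0 \<and> \<bar>s\<bar> < \<delta> \<and> t + s \<in> {0..1} \<longrightarrow>
      \<bar>(\<integral>\<omega>. (X (t + s) \<omega> - X t \<omega>)\<^sup>2 \<partial>M) / \<bar>s\<bar> powr \<alpha> t - c t\<bar> < \<epsilon>"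
    using assms unfolding locally_stationary_def rv_norm_square by blast
  obtain m where m: "m \<in> {0..1}" "\<And>t. t \<in> {0..1} \<Longrightarrow> c m \<le> c t"
    using continuous_attains_inf[OF compact_Icc _ c(1)] by fastforce
  define k where "k = c m / 2"
  have "k > 0" using c(2) m(1) by (simp add: k_def)
  obtain \<delta> where "\<delta> > 0" and \<delta>: "\<And>t s. t \<in> {0..1} \<Longrightarrow> s \<noteq> 0 \<Longrightarrow> \<bar>s\<bar> < \<delta> \<Longrightarrow> t + s \<in> {0..1} \<Longrightarrow>
      \<bar>(\<integral>\<omega>. (X (t + s) \<omega> - X t \<omega>)\<^sup>2 \<partial>M) / \<bar>s\<bar> powr \<alpha> t - c t\<bar> < k"
    using c(3)[OF \<open>k > 0\<close>] by metis
  show thesis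
  proof (rule that[OF \<open>k > 0\<close> \<open>\<delta> > 0\<close>])
    fix u t :: real
    assume ut: "0 \<le> u" "u < t" "t \<le> 1" "t - u < \<delta>"
    then have "\<bar>(\<integral>\<omega>. (X t \<omega> - X u \<omega>)\<^sup>2 \<partial>M) / (t - u) powr \<alpha> u - c u\<bar> < k"
      using \<delta>[of u "t - u"] by simp
    moreover have "c u \<ge> 2 * k"
      using m(2)[of u] ut by (simp add: k_def)
    ultimately have "k \<le> (\<integral>\<omega>. (X t \<omega> - X u \<omega>)\<^sup>2 \<partial>M) / (t - u) powr \<alpha> u"
      by linarith
    then show "k * (t - u) powr \<alpha> u \<le> (\<integral>\<omega>. (X t \<omega> - X u \<omega>)\<^sup>2 \<partial>M)"
      using ut by (simp add: pos_le_divide_eq)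
  qed
qed

section \<open>Sampling designs\<close>

lemma sampling_design_mono:
  assumes "sampling_design N \<tau>" "i \<le> j" "j \<le> N"
  shows "\<tau> i \<le> \<tau> j"
  using assms(2,3)
proof (induction j rule: dec_induct)
  case (step m)
  then have "\<tau> m < \<tau> (Suc m)"
    using assms(1) by (auto simp: sampling_design_def)
  with step show ?case by simp
qed simp

lemma sampling_design_range:
  assumes "sampling_design N \<tau>" "j \<le> N"
  shows "\<tau> j \<in> {0..1}"
  using sampling_design_mono[OF assms(1), of 0 j] sampling_design_mono[OF assms(1), of j N] assms
  by (auto simp: sampling_design_def)

lemma sampling_design_pos: "sampling_design N \<tau> \<Longrightarrow> N > 0"
  by (cases N) (auto simp: sampling_design_def)

lemma sampling_design_cover:
  assumes "sampling_design N \<tau>" "0 \<le> t" "t < 1"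
  obtains j where "j < N" "\<tau> j \<le> t" "t < \<tau> (Suc j)"
proof -
  define m where "m = (LEAST i. t < \<tau> i)"
  have "t < \<tau> N" "\<tau> 0 \<le> t"
    using assms by (auto simp: sampling_design_def)
  then have m: "t < \<tau> m" "m \<le> N"
    unfolding m_def by (auto intro: LeastI Least_le)
  then obtain j where j: "m = Suc j"
    using \<open>\<tau> 0 \<le> t\<close> by (cases m) auto
  then have "\<not> t < \<tau> j"
    unfolding m_def by (metis lessI not_less_Least)
  then show thesis
    using that[of j] m j by auto
qed

lemma pc_approx_eq:
  assumes "sampling_design N \<tau>" "j < N" "\<tau> j \<le> t" "t < \<tau> (Suc j)"
  shows "pc_approx X N \<tau> t = X (\<tau> j)"
proof -
  have unique: "i = j" if i: "i < N" "\<tau> i \<le> t" "t < \<tau> (Suc i)" for i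
  proof (rule ccontr)
    assume "i \<noteq> j"
    then consider "Suc i \<le> j" | "Suc j \<le> i" by linarith
    then show False
      using sampling_design_mono[OF assms(1), of "Suc i" j]
        sampling_design_mono[OF assms(1), of "Suc j" i] assms(2-4) i by cases auto
  qed
  have "(THE j. j < N \<and> \<tau> j \<le> t \<and> t < \<tau> (Suc j)) = j"
    using assms(2-4) by (intro the_equality) (blast, blast intro: unique)
  moreover have "\<exists>j<N. \<tau> j \<le> t \<and> t < \<tau> (Suc j)"
    using assms(2-4) by blast
  ultimately show ?thesis
    by (simp only: pc_approx_def if_True)
qed

lemma mesh_ge: "j < N \<Longrightarrow> \<tau> (Suc j) - \<tau> j \<le> mesh N \<tau>"
  by (simp add: mesh_def)

lemma measure_far_from_knots:
  fixes \<tau> :: "nat \<Rightarrow> real"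
  assumes "0 \<le> x" "0 \<le> \<mu>"
  shows "x - real N * \<mu> \<le> measure lborel ({0..<x} - (\<Union>j<N. {\<tau> j..<\<tau> j + \<mu>}))"
proof -
  let ?U = "\<Union>j<N. {\<tau> j..<\<tau> j + \<mu>}"
  have fin: "?U \<in> fmeasurable lborel"
    using assms by (intro fmeasurable.finite_UN) (auto intro!: fmeasurableI)
  have "x = measure lborel {0..<x}"
    using assms by simp
  also have "\<dots> \<le> measure lborel (({0..<x} - ?U) \<union> ?U)"
    using fin assms
    by (intro measure_mono_fmeasurable fmeasurable.Un fmeasurable_Diff) (auto intro!: fmeasurableI)
  also have "\<dots> \<le> measure lborel ({0..<x} - ?U) + measure lborel ?U"
    by (intro measure_Un_le) auto
  also have "measure lborel ?U \<le> (\<Sum>j<N. measure lborel {\<tau> j..<\<tau> j + \<mu>})"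
    by (intro measure_UNION_le) auto
  also have "\<dots> = real N * \<mu>"
    using assms by simp
  finally show ?thesis by simp
qed

section \<open>The integrated error of one design\<close>

lemma integrated_error_integrable:
  assumes ls: "locally_stationary M X \<alpha>" and d: "sampling_design N \<tau>"
  shows "set_integrable lborel {0..1} (\<lambda>t. \<integral>\<omega>. (X t \<omega> - pc_approx X N \<tau> t \<omega>)\<^sup>2 \<partial>M)"
    (is "set_integrable _ _ ?F")
proof -
  have "set_integrable lborel {\<tau> j..<\<tau> (Suc j)} ?F" if "j < N" for j
  proof -
    have r: "\<tau> j \<in> {0..1}" "\<tau> (Suc j) \<in> {0..1}"
      using sampling_design_range[OF d] that by auto
    then have "continuous_on {\<tau> j..\<tau> (Suc j)} (\<lambda>t. \<integral>\<omega>. (X t \<omega> - X (\<tau> j) \<omega>)\<^sup>2 \<partial>M)"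
      using locally_stationary_continuous[OF ls r(1)] by (auto elim: continuous_on_subset)
    then have "set_integrable lborel {\<tau> j..\<tau> (Suc j)} (\<lambda>t. \<integral>\<omega>. (X t \<omega> - X (\<tau> j) \<omega>)\<^sup>2 \<partial>M)"
      by (rule borel_integrable_atLeastAtMost')
    then have int: "set_integrable lborel {\<tau> j..<\<tau> (Suc j)} (\<lambda>t. \<integral>\<omega>. (X t \<omega> - X (\<tau> j) \<omega>)\<^sup>2 \<partial>M)"
      by (rule set_integrable_subset) auto
    have "?F t = (\<integral>\<omega>. (X t \<omega> - X (\<tau> j) \<omega>)\<^sup>2 \<partial>M)" if "t \<in> {\<tau> j..<\<tau> (Suc j)}" for t
      using pc_approx_eq[OF d \<open>j < N\<close>, of t X] that by simp
    then show ?thesis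
      by (rule set_integrable_cong[THEN iffD2, OF refl refl _ int])
  qed
  then have "set_integrable lborel (\<Union>j\<in>{..<N}. {\<tau> j..<\<tau> (Suc j)}) ?F"
    by (intro set_integrable_UN) auto
  moreover have "set_integrable lborel {1} ?F"
  proof (rule set_integrable_cong[THEN iffD2, OF refl refl])
    show "?F t = ?F 1" if "t \<in> {1}" for t
      using that by simp
    show "set_integrable lborel {1} (\<lambda>_. ?F 1)"
      by (simp add: set_integrable_def)
  qed
  ultimately have "set_integrable lborel ((\<Union>j\<in>{..<N}. {\<tau> j..<\<tau> (Suc j)}) \<union> {1}) ?F"
    by (intro set_integrable_Un) auto
  moreover have "(\<Union>j\<in>{..<N}. {\<tau> j..<\<tau> (Suc j)}) \<union> {1} = {0..1}"
  proof (intro equalityI subsetI)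
    fix t :: real
    assume t: "t \<in> {0..1}"
    show "t \<in> (\<Union>j\<in>{..<N}. {\<tau> j..<\<tau> (Suc j)}) \<union> {1}"
    proof (cases "t = 1")
      case False
      then obtain j where "j < N" "\<tau> j \<le> t" "t < \<tau> (Suc j)"
        using sampling_design_cover[OF d, of t] t by force
      then show ?thesis by auto
    qed simp
  next
    fix t :: real
    assume "t \<in> (\<Union>j\<in>{..<N}. {\<tau> j..<\<tau> (Suc j)}) \<union> {1}"
    then consider j where "j < N" "\<tau> j \<le> t" "t < \<tau> (Suc j)" | "t = 1"
      by auto
    then show "t \<in> {0..1}"
    proof cases
      case (1 j)
      then show ?thesis
        using sampling_design_range[OF d, of j] sampling_design_range[OF d, of "Suc j"] by auto
    qed simp
  qed
  ultimately show ?thesis by simp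
qed

text \<open>
  At a point whose distance to its left knot is at least \<open>\<mu> = x / (2N)\<close>, the error is at least
  \<open>k \<mu> powr q\<close>; the choice of \<open>\<mu>\<close> leaves half of \<open>[0, x)\<close> for such points.
\<close>

lemma integrated_error_ge:
  assumes ls: "locally_stationary M X \<alpha>" and d: "sampling_design N \<tau>"
    and mesh: "mesh N \<tau> < \<delta>"
    and incr: "\<And>u t. 0 \<le> u \<Longrightarrow> u < t \<Longrightarrow> t \<le> 1 \<Longrightarrow> t - u < \<delta> \<Longrightarrow>
       k * (t - u) powr \<alpha> u \<le> (\<integral>\<omega>. (X t \<omega> - X u \<omega>)\<^sup>2 \<partial>M)"
    and "k > 0" and x: "0 < x" "x \<le> 1"
    and q: "\<And>u. 0 \<le> u \<Longrightarrow> u < x \<Longrightarrow> \<alpha> u \<le> q"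
  shows "k * (x / (2 * real N)) powr q * (x / 2)
    \<le> (LINT t:{0..1}|lborel. (\<integral>\<omega>. (X t \<omega> - pc_approx X N \<tau> t \<omega>)\<^sup>2 \<partial>M))"
proof -
  let ?F = "\<lambda>t. \<integral>\<omega>. (X t \<omega> - pc_approx X N \<tau> t \<omega>)\<^sup>2 \<partial>M"
  define \<mu> where "\<mu> = x / (2 * real N)"
  define G where "G = {0..<x} - (\<Union>j<N. {\<tau> j..<\<tau> j + \<mu>})"
  have "N > 0" by (rule sampling_design_pos[OF d])
  have \<mu>: "0 < \<mu>" "\<mu> \<le> 1" "real N * \<mu> = x / 2"
    using x \<open>N > 0\<close> by (auto simp: \<mu>_def field_simps)
  have G: "G \<in> fmeasurable lborel"
    unfolding G_def using x by (intro fmeasurable_Diff) (auto intro!: fmeasurableI)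
  have ge: "k * \<mu> powr q \<le> ?F t" if t: "t \<in> G" for t
  proof -
    have "0 \<le> t" "t < x" using t by (auto simp: G_def)
    then obtain j where j: "j < N" "\<tau> j \<le> t" "t < \<tau> (Suc j)"
      using sampling_design_cover[OF d, of t] x by auto
    have far: "\<mu> \<le> t - \<tau> j"
      using t j by (force simp: G_def)
    have r: "\<tau> j \<in> {0..1}"
      using sampling_design_range[OF d] j by auto
    have "\<mu> powr q \<le> \<mu> powr \<alpha> (\<tau> j)"
      using \<mu> q[of "\<tau> j"] r j \<open>t < x\<close> by (intro powr_mono') auto
    also have "\<dots> \<le> (t - \<tau> j) powr \<alpha> (\<tau> j)"
      using ls r far \<mu> by (intro powr_mono2) (auto simp: locally_stationary_def less_imp_le)
    finally have "k * \<mu> powr q \<le> k * (t - \<tau> j) powr \<alpha> (\<tau> j)"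
      using \<open>k > 0\<close> by simp
    also have "\<dots> \<le> (\<integral>\<omega>. (X t \<omega> - X (\<tau> j) \<omega>)\<^sup>2 \<partial>M)"
      using incr[of "\<tau> j" t] r far \<mu> j mesh mesh_ge[of j N \<tau>] \<open>t < x\<close> x by simp
    also have "\<dots> = ?F t"
      by (simp add: pc_approx_eq[OF d j])
    finally show ?thesis .
  qed
  have "x / 2 \<le> measure lborel G"
    using measure_far_from_knots[of x \<mu> N \<tau>] \<mu> x by (simp add: G_def)
  then have "k * \<mu> powr q * (x / 2) \<le> k * \<mu> powr q * measure lborel G"
    using \<open>k > 0\<close> by (intro mult_left_mono) auto
  also have "\<dots> = (LINT t|lborel. indicator G t * (k * \<mu> powr q))"
    by simp
  also have "\<dots> \<le> (LINT t:{0..1}|lborel. ?F t)"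
    unfolding set_lebesgue_integral_def
  proof (rule integral_mono)
    show "integrable lborel (\<lambda>t. indicator G t * (k * \<mu> powr q))"
      using G by (auto intro!: integrable_mult_left integrable_real_indicator simp: fmeasurable_def)
    show "integrable lborel (\<lambda>t. indicator {0..1} t *\<^sub>R ?F t)"
      using integrated_error_integrable[OF ls d] by (simp add: set_integrable_def)
    show "indicator G t * (k * \<mu> powr q) \<le> indicator {0..1} t *\<^sub>R ?F t" for t
      using ge[of t] x by (auto simp: indicator_def G_def)
  qed
  finally show ?thesis by (simp add: \<mu>_def)
qed

section \<open>The rate\<close>

text \<open>
  After taking logarithms the terms in \<open>a ln n\<close> and \<open>((a + 1) / \<gamma>) ln (ln n)\<close> cancel, and the rest is
  bounded because \<open>ln (ln n) \<le> ln n\<close>.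
\<close>

lemma rate_bounded_below:
  fixes a B \<gamma> n m :: real
  assumes "0 \<le> a" "0 \<le> B" "\<gamma> > 0" "ln n \<ge> 1" "0 < m" "m \<le> 2 * n"
  defines "x \<equiv> ln n powr (- 1 / \<gamma>)"
  shows "exp (- (a * ln 4 + B + B * ln 4 + B / \<gamma>))
    \<le> n powr a * ln n powr ((a + 1) / \<gamma>) * ((x / (2 * m)) powr (a + B / ln n) * x)"
proof -
  define L where "L = ln n"
  have L: "L \<ge> 1" using assms by (simp add: L_def)
  have n: "n > 0" using assms by linarith
  have x: "x = exp (- (ln L / \<gamma>))" "x > 0"
    using L by (auto simp: x_def L_def[symmetric] powr_def)
  have "ln L \<le> L" "0 \<le> ln L"
    using L ln_le_minus_one[of L] by auto
  have "exp (- (ln L / \<gamma>) - ln 4 - L) = x / (4 * n)"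
    using n by (simp add: exp_diff x L_def)
  also have "\<dots> \<le> x / (2 * m)"
    using assms x by (intro divide_left_mono) auto
  \<comment> \<open>Replacing the base by the smaller \<open>x / (4 n)\<close> leaves a pure exponential in \<open>L\<close> and \<open>ln L\<close>.\<close>
  finally have "exp (- (ln L / \<gamma>) - ln 4 - L) powr (a + B / L) \<le> (x / (2 * m)) powr (a + B / L)"
    using assms L by (intro powr_mono2) auto
  then have 1: "exp ((a + B / L) * (- (ln L / \<gamma>) - ln 4 - L)) \<le> (x / (2 * m)) powr (a + B / L)"
    by (simp add: powr_def)
  have "B * ln 4 / L \<le> B * ln 4"
    using L assms(2) divide_left_mono[of 1 L "B * ln 4"] by simp
  moreover have "B / \<gamma> * (ln L / L) \<le> B / \<gamma> * 1"
    using L assms \<open>ln L \<le> L\<close> by (intro mult_left_mono) auto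
  moreover have "a * L + (a + 1) / \<gamma> * ln L + ((a + B / L) * (- (ln L / \<gamma>) - ln 4 - L) - ln L / \<gamma>)
      = - (a * ln 4 + B + B * ln 4 / L + B / \<gamma> * (ln L / L))"
    using L \<open>\<gamma> > 0\<close> by (simp add: field_simps)
  ultimately have "- (a * ln 4 + B + B * ln 4 + B / \<gamma>)
      \<le> a * L + (a + 1) / \<gamma> * ln L + ((a + B / L) * (- (ln L / \<gamma>) - ln 4 - L) - ln L / \<gamma>)"
    by linarith
  then have "exp (- (a * ln 4 + B + B * ln 4 + B / \<gamma>))
      \<le> exp (a * L + (a + 1) / \<gamma> * ln L + ((a + B / L) * (- (ln L / \<gamma>) - ln 4 - L) - ln L / \<gamma>))"
    by (simp only: exp_le_cancel_iff)
  also have "\<dots> = n powr a * L powr ((a + 1) / \<gamma>) * (exp ((a + B / L) * (- (ln L / \<gamma>) - ln 4 - L)) * x)"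
    using n L by (simp add: powr_def L_def[symmetric] x(1) exp_add[symmetric])
  also have "\<dots> \<le> n powr a * L powr ((a + 1) / \<gamma>) * ((x / (2 * m)) powr (a + B / L) * x)"
    using 1 x(2) by (intro mult_left_mono mult_right_mono) auto
  finally show ?thesis by (simp add: L_def)
qed

theorem proposition1:
  fixes M :: "'a measure" and X :: "real \<Rightarrow> 'a \<Rightarrow> real"
    and \<alpha> :: "real \<Rightarrow> real" and b \<gamma> :: real
    and N :: "nat \<Rightarrow> nat" and \<tau> :: "nat \<Rightarrow> nat \<Rightarrow> real"
  assumes "prob_space M"
    and "locally_stationary M X \<alpha>"
    and C1: "\<And>t. is_arg_min \<alpha> (\<lambda>s. s \<in> {0..1}) t \<longleftrightarrow> t = 0"
    and C2: "b > 0" "\<gamma> > 0"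
      "(\<lambda>t. \<alpha> t - (\<alpha> 0 + b * t powr \<gamma>)) \<in> o[at_right 0](\<lambda>t. t powr \<gamma>)"
    and "\<And>n. n \<ge> 1 \<Longrightarrow> sampling_design (N n) (\<tau> n)"
    and "(\<lambda>n. real (N n)) \<sim>[sequentially] (\<lambda>n. real n)"
    and "(\<lambda>n. mesh (N n) (\<tau> n)) \<longlonglongrightarrow> 0"
  shows "Liminf sequentially (\<lambda>n. ereal (real n powr \<alpha> 0 * ln (real n) powr ((\<alpha> 0 + 1) / \<gamma>) *
           (LINT t:{0..1}|lborel. (\<integral>\<omega>. (X t \<omega> - pc_approx X (N n) (\<tau> n) t \<omega>)\<^sup>2 \<partial>M)))) > 0"
proof -
  note ls = assms(2) and design = assms(7)
  obtain k \<delta> where "k > 0" "\<delta> > 0" and incr: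
    "\<And>u t. 0 \<le> u \<Longrightarrow> u < t \<Longrightarrow> t \<le> 1 \<Longrightarrow> t - u < \<delta> \<Longrightarrow>
       k * (t - u) powr \<alpha> u \<le> (\<integral>\<omega>. (X t \<omega> - X u \<omega>)\<^sup>2 \<partial>M)"
    using locally_stationary_increment_ge[OF ls] by blast
  have "\<alpha> 0 > 0" using ls by (auto simp: locally_stationary_def)
  \<comment> \<open>The remainder in (C2) is eventually at most its leading term \<open>b t powr \<gamma>\<close>, whence the factor 2
    in \<open>\<alpha>_le\<close>.\<close>
  have "\<forall>\<^sub>F t in at_right 0. norm (\<alpha> t - (\<alpha> 0 + b * t powr \<gamma>)) \<le> b * norm (t powr \<gamma>)"
    by (rule landau_o.smallD[OF C2(3) C2(1)])
  then obtain \<rho> where "\<rho> > 0" and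
    \<rho>: "\<And>t. 0 < t \<Longrightarrow> t < \<rho> \<Longrightarrow> norm (\<alpha> t - (\<alpha> 0 + b * t powr \<gamma>)) \<le> b * norm (t powr \<gamma>)"
    by (auto simp: eventually_at_right_field)
  have \<alpha>_le: "\<alpha> t \<le> \<alpha> 0 + 2 * b * t powr \<gamma>" if "0 \<le> t" "t < \<rho>" for t
    using \<rho>[of t] that by (cases "t = 0") auto
  define x where "x = (\<lambda>n. ln (real n) powr (- 1 / \<gamma>))"
  \<comment> \<open>The constant of \<open>rate_bounded_below\<close> for \<open>a = \<alpha> 0\<close> and \<open>B = 2b\<close>; the factor \<open>k / 2\<close> comes from
    \<open>integrated_error_ge\<close>.\<close>
  define C where "C = k / 2 * exp (- (\<alpha> 0 * ln 4 + 2 * b + 2 * b * ln 4 + 2 * b / \<gamma>))"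
  have "C > 0" using \<open>k > 0\<close> by (simp add: C_def)
  have ln_top: "filterlim (\<lambda>n. ln (real n)) at_top sequentially"
    by (rule filterlim_compose[OF ln_at_top filterlim_real_sequentially])
  have "x \<longlonglongrightarrow> 0"
    unfolding x_def using C2 by (intro tendsto_neg_powr ln_top) auto
  have "\<forall>\<^sub>F n in sequentially. x n < min \<rho> 1"
    using \<open>x \<longlonglongrightarrow> 0\<close> \<open>\<rho> > 0\<close> by (intro order_tendstoD(2)) auto
  moreover have "\<forall>\<^sub>F n in sequentially. ln (real n) \<ge> 1"
    using ln_top by (auto simp: filterlim_at_top)
  moreover have "\<forall>\<^sub>F n in sequentially. mesh (N n) (\<tau> n) < \<delta>"
    using assms(9) \<open>\<delta> > 0\<close> by (intro order_tendstoD(2)) auto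
  moreover have "\<forall>\<^sub>F n in sequentially.
      (if real (N n) = 0 \<and> real n = 0 then 1 else real (N n) / real n) < 2"
    using asymp_equivD[OF assms(8)] by (rule order_tendstoD(2)) simp
  moreover have "\<forall>\<^sub>F n in sequentially. n \<ge> 1"
    by (rule eventually_ge_at_top)
  ultimately have "\<forall>\<^sub>F n in sequentially. C \<le> real n powr \<alpha> 0 * ln (real n) powr ((\<alpha> 0 + 1) / \<gamma>) *
      (LINT t:{0..1}|lborel. (\<integral>\<omega>. (X t \<omega> - pc_approx X (N n) (\<tau> n) t \<omega>)\<^sup>2 \<partial>M))"
  proof eventually_elim
    case (elim n)
    define q where "q = \<alpha> 0 + 2 * b / ln (real n)"
    have x: "0 < x n" "x n \<le> 1" "x n < \<rho>"
      using elim by (auto simp: x_def)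
    have x_powr: "x n powr \<gamma> = 1 / ln (real n)"
    proof -
      have "x n powr \<gamma> = ln (real n) powr (- 1 / \<gamma> * \<gamma>)"
        by (simp only: x_def powr_powr)
      also have "- 1 / \<gamma> * \<gamma> = - 1"
        using C2(2) by simp
      finally show ?thesis
        using elim by (simp add: powr_minus_divide)
    qed
    have q: "\<alpha> u \<le> q" if "0 \<le> u" "u < x n" for u
    proof -
      have "\<alpha> u \<le> \<alpha> 0 + 2 * b * u powr \<gamma>"
        using \<alpha>_le that x by simp
      also have "\<dots> \<le> \<alpha> 0 + 2 * b * x n powr \<gamma>"
        using that C2 by (intro add_left_mono mult_left_mono powr_mono2) auto
      finally show ?thesis
        using x_powr by (simp add: q_def)
    qed
    have N: "0 < real (N n)" "real (N n) \<le> 2 * real n"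
      using sampling_design_pos[OF design] elim by (auto simp: divide_less_eq)
    have "C \<le> k / 2 * (real n powr \<alpha> 0 * ln (real n) powr ((\<alpha> 0 + 1) / \<gamma>)
        * ((x n / (2 * real (N n))) powr q * x n))"
      unfolding C_def q_def x_def using \<open>k > 0\<close> \<open>\<alpha> 0 > 0\<close> C2 elim N
      by (intro mult_left_mono rate_bounded_below) auto
    also have "\<dots> = real n powr \<alpha> 0 * ln (real n) powr ((\<alpha> 0 + 1) / \<gamma>)
        * (k * (x n / (2 * real (N n))) powr q * (x n / 2))"
      by simp
    also have "\<dots> \<le> real n powr \<alpha> 0 * ln (real n) powr ((\<alpha> 0 + 1) / \<gamma>) *
      (LINT t:{0..1}|lborel. (\<integral>\<omega>. (X t \<omega> - pc_approx X (N n) (\<tau> n) t \<omega>)\<^sup>2 \<partial>M))"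
      using integrated_error_ge[OF ls design _ incr \<open>k > 0\<close> x(1,2) q] elim
      by (intro mult_left_mono) auto
    finally show ?case .
  qed
  then have "ereal C \<le> Liminf sequentially (\<lambda>n. ereal (real n powr \<alpha> 0 * ln (real n) powr ((\<alpha> 0 + 1) / \<gamma>) *
      (LINT t:{0..1}|lborel. (\<integral>\<omega>. (X t \<omega> - pc_approx X (N n) (\<tau> n) t \<omega>)\<^sup>2 \<partial>M))))"
    by (intro Liminf_bounded) simp
  moreover have "0 < ereal C"
    using \<open>C > 0\<close> by simp
  ultimately show ?thesis
    by (rule less_le_trans[rotated])
qed

end
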